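(* Let $d\ge1$ be an integer and $0<p<\infty$. Suppose that $\phi:(0,\infty)\to(0,\infty)$ is a (measurable) function that is regularly varying at the origin of index $\rho_0$, regularly varying at infinity of index $\rho_\infty$, and bounded and bounded away from zero on every compact subset of $(0,\infty)$. Suppose that either $0<\rho_0<d$ and $0<\rho_\infty<d$, or $\rho_0>d$ and $\rho_\infty>d$. Then there exists a constant $c=c(\phi,d,p)$ such that the inequality $$\int_{\mathbb{R}^d\setminus\{0\}}\frac{|u(x)|^p}{\phi(|x|)}\,dx\le c\int_{\mathbb{R}^d\setminus\{0\}}\int_{\mathbb{R}^d\setminus\{0\}}\frac{|u(x)-u(y)|^p}{\phi(|x-y|)\,|x-y|^d}\,dy\,dx$$ holds for every measurable function $u$ for which the left-hand side is finite.
   Context: A function $\phi:(0,\infty)\to(0,\infty)$ is regularly varying at the origin (resp. at infinity) with index $\rho\in\mathbb{R}$ if for every $\lambda>0$ one has $\phi(\lambda x)/\phi(x)\to\lambda^{\rho}$ as $x\to0_+$ (resp. as $x\to\infty$). *)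

theory Defs
  imports "HOL-Analysis.Analysis"
begin

definition regularly_varying_at_zero :: "(real \<Rightarrow> real) \<Rightarrow> real \<Rightarrow> bool" where
  "regularly_varying_at_zero \<phi> \<rho> \<longleftrightarrow>
     (\<forall>l>0. ((\<lambda>x. \<phi> (l * x) / \<phi> x) \<longlongrightarrow> l powr \<rho>) (at_right 0))"

definition regularly_varying_at_infinity :: "(real \<Rightarrow> real) \<Rightarrow> real \<Rightarrow> bool" where
  "regularly_varying_at_infinity \<phi> \<rho> \<longleftrightarrow>
     (\<forall>l>0. ((\<lambda>x. \<phi> (l * x) / \<phi> x) \<longlongrightarrow> l powr \<rho>) at_top)"

end

theory Submission
  imports Defs
begin

text \<open>The Hardy inequality follows from averaging over annuli. Put \<open>d = CARD('n)\<close> and let \<open>R\<close> be a fixed dilation factor.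
For every \<open>y\<close> in the annulus \<open>R * norm x \<le> norm y \<le> 2 * R * norm x\<close> one has
\<open>\<bar>u x\<bar> powr p \<le> 2 powr p * (\<bar>u x - u y\<bar> powr p + \<bar>u y\<bar> powr p)\<close>. Average this over the annulus, divide by \<open>\<phi> (norm x)\<close> and
integrate in \<open>x\<close>. The difference term is bounded by the double integral, since \<open>norm (x - y)\<close> is comparable to \<open>norm x\<close> on
the annulus. By Fubini, the remaining term is at most a small multiple of the left-hand side as soon as
\<open>\<phi> (l * t) \<le> \<delta> * l ^ d * \<phi> t\<close> for all \<open>t > 0\<close> and \<open>R \<le> l \<le> 2 * R\<close>, with \<open>\<delta>\<close> small; since the left-hand side is finite, it can be
absorbed (lemma \<open>hardy_by_averaging\<close>).

Such an \<open>R\<close> exists because \<open>\<phi> t / t ^ d\<close> has indices of the same sign at both ends: a large \<open>R\<close> works if both indices of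
\<open>\<phi>\<close> are below \<open>d\<close>, a small one if both exceed \<open>d\<close> (lemma \<open>small_dilation_ratio\<close>). The estimate must be uniform in
\<open>t\<close> and \<open>l\<close>, while regular variation is a pointwise statement in the dilation. Uniformity comes from the
uniform convergence theorem for measurable regularly varying functions, needed here only in the form
that \<open>\<phi> s\<close> and \<open>\<phi> t\<close> are comparable when \<open>s\<close> and \<open>t\<close> differ by a factor at most 2 (lemma \<open>doubling\<close>). Potter type bounds
then follow by iterating along powers of two (lemma \<open>geometric_decay\<close>).\<close>

section \<open>Local uniformity of regular variation\<close>

lemma lmeasurable_exceptional:
  fixes g :: "real \<Rightarrow> real"
  assumes [measurable]: "g \<in> borel_measurable lebesgue"
  shows "{y\<in>{1..4}. \<not> (1 / K < g y \<and> g y < K)} \<in> lmeasurable"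
proof -
  have "{y\<in>{1..4}. \<not> (1 / K < g y \<and> g y < K)}
      = {1..4} \<inter> {y \<in> space lebesgue. \<not> (1 / K < g y \<and> g y < K)}"
    by auto
  also have "\<dots> \<in> sets lebesgue"
    by (rule sets.Int) (simp, measurable)
  finally show ?thesis
    by (rule bounded_set_imp_lmeasurable[rotated])
       (rule bounded_subset[OF bounded_closed_interval[of 1 4]], auto)
qed

text \<open>Pointwise convergence on a set of finite measure implies convergence in measure. This is the step that
upgrades the pointwise limits in the definition of regular variation to statements about most dilations.\<close>
lemma measure_exceptional_tendsto_0:
  fixes g :: "nat \<Rightarrow> real \<Rightarrow> real"
  assumes meas: "\<And>n. g n \<in> borel_measurable lebesgue"
    and lim: "\<And>y. y \<in> {1..4} \<Longrightarrow> (\<lambda>n. g n y) \<longlonglongrightarrow> h y"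
    and bnd: "\<And>y. y \<in> {1..4} \<Longrightarrow> 1 / K < h y \<and> h y < K"
  shows "(\<lambda>n. measure lebesgue {y\<in>{1..4}. \<not> (1 / K < g n y \<and> g n y < K)}) \<longlonglongrightarrow> 0"
proof -
  define B where "B n = {y\<in>{1..4}. \<not> (1 / K < g n y \<and> g n y < K)}" for n
  have B_sets: "B n \<in> sets lebesgue" for n
    unfolding B_def using lmeasurable_exceptional[OF meas] by blast
  have "(\<lambda>n. integral\<^sup>L lebesgue (indicator (B n) :: real \<Rightarrow> real)) \<longlonglongrightarrow> integral\<^sup>L lebesgue (\<lambda>_::real. 0 :: real)"
  proof (rule integral_dominated_convergence[where w = "indicator {1..4}"])
    show "integrable lebesgue (indicator {1..4::real} :: real \<Rightarrow> real)"
      by (rule integrable_real_indicator) (auto simp: emeasure_lborel_Icc_eq)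
    show "AE x in lebesgue. (\<lambda>n. indicator (B n) x :: real) \<longlonglongrightarrow> 0"
    proof (rule AE_I2)
      fix y :: real
      have "\<forall>\<^sub>F n in sequentially. y \<notin> B n"
      proof (cases "y \<in> {1..4}")
        case True
        then show ?thesis
          using eventually_conj[OF order_tendstoD(1)[OF lim[OF True]] order_tendstoD(2)[OF lim[OF True]]]
            bnd[OF True] by (force simp: B_def elim: eventually_mono)
      qed (auto simp: B_def)
      then have "\<forall>\<^sub>F n in sequentially. indicator (B n) y = (0::real)"
        by (rule eventually_mono) simp
      then show "(\<lambda>n. indicator (B n) y :: real) \<longlonglongrightarrow> 0"
        by (rule tendsto_eventually)
    qed
  qed (use B_sets in \<open>auto simp: B_def indicator_def\<close>)
  then show "(\<lambda>n. measure lebesgue {y\<in>{1..4}. \<not> (1 / K < g n y \<and> g n y < K)}) \<longlonglongrightarrow> 0"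
    using B_sets by (simp add: B_def)
qed

text \<open>The core of the uniform convergence theorem for regularly varying functions. For large \<open>n\<close>, most \<open>y\<close> make
\<open>\<phi> (y * x n)\<close> comparable to \<open>\<phi> (x n)\<close>, and most \<open>y\<close> make \<open>\<phi> (y * x n)\<close> comparable to \<open>\<phi> (w n)\<close>.
Two sets of almost full measure meet, and a common \<open>y\<close> compares \<open>\<phi> (x n)\<close> with \<open>\<phi> (w n)\<close>.
Measurability of \<open>\<phi>\<close> is what makes this possible.\<close>
lemma ratio_bounded_along_sequences:
  fixes \<phi> :: "real \<Rightarrow> real"
  assumes meas: "\<phi> \<in> borel_measurable lebesgue"
    and pos: "\<And>t. t > 0 \<Longrightarrow> \<phi> t > 0"
    and x: "\<And>n. x n > 0"
    and w: "\<And>n. x n \<le> w n \<and> w n \<le> 2 * x n"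
    and limx: "\<And>l. l > 0 \<Longrightarrow> (\<lambda>n. \<phi> (l * x n) / \<phi> (x n)) \<longlonglongrightarrow> l powr \<rho>"
    and limw: "\<And>l. l > 0 \<Longrightarrow> (\<lambda>n. \<phi> (l * w n) / \<phi> (w n)) \<longlonglongrightarrow> l powr \<rho>"
    and K: "K = 2 * 4 powr \<bar>\<rho>\<bar>"
  shows "\<exists>n. \<phi> (w n) \<le> K\<^sup>2 * \<phi> (x n) \<and> \<phi> (x n) \<le> K\<^sup>2 * \<phi> (w n)"
proof -
  have K_bnd: "1 / K < y powr \<rho> \<and> y powr \<rho> < K" if y: "y \<in> {1..4}" for y :: real
  proof -
    have "y powr \<rho> \<le> y powr \<bar>\<rho>\<bar>" "y powr (-\<bar>\<rho>\<bar>) \<le> y powr \<rho>"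
      using y by (auto intro!: powr_mono)
    moreover have "y powr \<bar>\<rho>\<bar> \<le> 4 powr \<bar>\<rho>\<bar>" using y by (intro powr_mono2) auto
    moreover have "y powr (-\<bar>\<rho>\<bar>) \<ge> 1 / 4 powr \<bar>\<rho>\<bar>"
      using y \<open>y powr \<bar>\<rho>\<bar> \<le> 4 powr \<bar>\<rho>\<bar>\<close> by (simp add: powr_minus_divide frac_le)
    moreover have "(4::real) powr \<bar>\<rho>\<bar> > 0" by simp
    moreover have "1 / K < 1 / 4 powr \<bar>\<rho>\<bar>" using \<open>(4::real) powr \<bar>\<rho>\<bar> > 0\<close> unfolding K
      by (simp add: divide_simps)
    ultimately show ?thesis unfolding K by linarith
  qed
  have scale: "(\<lambda>y. \<phi> (y * c) / \<phi> c) \<in> borel_measurable lebesgue" for c :: real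
    using measurable_compose[OF lebesgue_measurable_scaling[of c] meas] by (simp add: mult.commute)
  define B where "B z = {y\<in>{1..4}. \<not> (1 / K < \<phi> (y * z) / \<phi> z \<and> \<phi> (y * z) / \<phi> z < K)}" for z
  have lim0: "(\<lambda>n. measure lebesgue (B (z n))) \<longlonglongrightarrow> 0"
    if "\<And>l. l > 0 \<Longrightarrow> (\<lambda>n. \<phi> (l * z n) / \<phi> (z n)) \<longlonglongrightarrow> l powr \<rho>" for z
    unfolding B_def
    by (rule measure_exceptional_tendsto_0[where h = "\<lambda>y. y powr \<rho>"])
       (use K_bnd that scale in auto)
  have lm: "B z \<in> lmeasurable" for z
    unfolding B_def by (rule lmeasurable_exceptional[OF scale])
  have "\<forall>\<^sub>F n in sequentially. measure lebesgue (B (x n)) < 1/2 \<and> measure lebesgue (B (w n)) < 1/2"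
    using order_tendstoD(2)[OF lim0[OF limx], of "1/2"] order_tendstoD(2)[OF lim0[OF limw], of "1/2"]
    by (intro eventually_conj) auto
  then obtain n where n: "measure lebesgue (B (x n)) < 1/2" "measure lebesgue (B (w n)) < 1/2"
    by (auto simp: eventually_sequentially)
  define l where "l = w n / x n"
  have l: "1 \<le> l" "l \<le> 2" "w n = l * x n"
    using x[of n] w[of n] by (auto simp: l_def field_simps)
  have scaled: "measure lebesgue ((*\<^sub>R) l ` B (w n)) = l * measure lebesgue (B (w n))"
    using measure_lebesgue_affine[of l 0 "B (w n)"] l by (simp add: image_def)
  have lm': "(*\<^sub>R) l ` B (w n) \<in> lmeasurable"
  proof (rule fmeasurableI)
    have "(*\<^sub>R) l ` B (w n) = (*\<^sub>R) (1 / l) -` B (w n) \<inter> space lebesgue"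
      using l by (force simp: image_def)
    also have "\<dots> \<in> sets lebesgue"
      using lm by (intro measurable_sets[OF lebesgue_measurable_scaling]) blast
    finally show "(*\<^sub>R) l ` B (w n) \<in> sets lebesgue" .
    show "emeasure lebesgue ((*\<^sub>R) l ` B (w n)) < \<infinity>"
      using emeasure_lebesgue_affine[of l 0 "B (w n)"] lm[of "w n"]
      by (simp add: fmeasurable_def ennreal_mult_less_top del: emeasure_completion)
  qed
  \<comment> \<open>The rescaled set lives in \<open>{l..4 * l}\<close>, which contains \<open>{2..4}\<close>; the bad sets have total measure below \<open>1/2 + 2 * 1/2 < 2\<close>.\<close>
  have "\<not> {2..4} \<subseteq> B (x n) \<union> (*\<^sub>R) l ` B (w n)"
  proof
    assume "{2..4} \<subseteq> B (x n) \<union> (*\<^sub>R) l ` B (w n)"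
    then have "measure lebesgue {2..4::real} \<le> measure lebesgue (B (x n) \<union> (*\<^sub>R) l ` B (w n))"
      by (intro measure_mono_fmeasurable fmeasurable.Un lm lm') auto
    also have "\<dots> \<le> measure lebesgue (B (x n)) + l * measure lebesgue (B (w n))"
      unfolding scaled[symmetric] using lm lm' by (intro measure_Un_le) auto
    also have "\<dots> \<le> measure lebesgue (B (x n)) + 2 * measure lebesgue (B (w n))"
      using l by (intro add_left_mono mult_right_mono) auto
    also have "\<dots> < 2" using n by linarith
    finally show False by simp
  qed
  then obtain y where y: "y \<in> {2..4}" "y \<notin> B (x n)" "y \<notin> (*\<^sub>R) l ` B (w n)" by blast
  have "y / l \<in> {1..4}" using y l by (auto simp: field_simps)
  moreover have "y / l \<notin> B (w n)" using y(3) l by (force simp: image_def)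
  moreover have "y / l * w n = y * x n" using l by simp
  ultimately have 1: "1 / K < \<phi> (y * x n) / \<phi> (w n)" "\<phi> (y * x n) / \<phi> (w n) < K"
    by (auto simp: B_def)
  have 2: "1 / K < \<phi> (y * x n) / \<phi> (x n)" "\<phi> (y * x n) / \<phi> (x n) < K"
    using y by (auto simp: B_def)
  have px: "\<phi> (x n) > 0" using pos x by blast
  have pw: "\<phi> (w n) > 0" using pos x[of n] w[of n] by fastforce
  have Kp: "K > 0" by (simp add: K)
  have a: "\<phi> (w n) \<le> K * \<phi> (y * x n)" "\<phi> (y * x n) \<le> K * \<phi> (w n)"
    using 1 pw Kp by (simp_all add: field_simps)
  have b: "\<phi> (x n) \<le> K * \<phi> (y * x n)" "\<phi> (y * x n) \<le> K * \<phi> (x n)"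
    using 2 px Kp by (simp_all add: field_simps)
  have "\<phi> (w n) \<le> K * (K * \<phi> (x n))"
    using a(1) mult_left_mono[OF b(2), of K] Kp by linarith
  moreover have "\<phi> (x n) \<le> K * (K * \<phi> (w n))"
    using b(1) mult_left_mono[OF a(2), of K] Kp by linarith
  ultimately show ?thesis by (auto simp: power2_eq_square mult.assoc)
qed

text \<open>A form of the uniform convergence theorem that serves both ends of the half-line: \<open>S n\<close> is a shrinking
family of neighbourhoods of the end in question, and \<open>F\<close> the corresponding filter. If the doubling bound
failed on every \<open>S n\<close>, the counterexamples would form sequences excluded by the previous lemma.\<close>
lemma locally_uniform_doubling:
  fixes \<phi> :: "real \<Rightarrow> real"
  assumes meas: "\<phi> \<in> borel_measurable (lebesgue_on {0<..})"
    and pos: "\<And>t. t > 0 \<Longrightarrow> \<phi> t > 0"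
    and rv: "\<And>l. l > 0 \<Longrightarrow> ((\<lambda>x. \<phi> (l * x) / \<phi> x) \<longlongrightarrow> l powr \<rho>) F"
    and C: "C = (2 * 4 powr \<bar>\<rho>\<bar>)\<^sup>2"
    and F: "\<And>x w :: nat \<Rightarrow> real. (\<And>n. x n > 0 \<and> x n \<le> w n \<and> w n \<le> 2 * x n \<and> x n \<in> S n) \<Longrightarrow>
       filterlim x F sequentially \<and> filterlim w F sequentially"
  shows "\<exists>n. \<forall>s t. s \<in> S n \<longrightarrow> 0 < s \<longrightarrow> s \<le> t \<longrightarrow> t \<le> 2 * s \<longrightarrow> \<phi> t \<le> C * \<phi> s \<and> \<phi> s \<le> C * \<phi> t"
proof (rule ccontr)
  assume "\<not> ?thesis"
  then have "\<forall>n. \<exists>s t. s \<in> S n \<and> 0 < s \<and> s \<le> t \<and> t \<le> 2 * s \<and> \<not> (\<phi> t \<le> C * \<phi> s \<and> \<phi> s \<le> C * \<phi> t)"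
    by blast
  then obtain x w where xw: "\<And>n. x n \<in> S n \<and> 0 < x n \<and> x n \<le> w n \<and> w n \<le> 2 * x n"
      "\<And>n. \<not> (\<phi> (w n) \<le> C * \<phi> (x n) \<and> \<phi> (x n) \<le> C * \<phi> (w n))"
    by metis
  have lim: "filterlim x F sequentially" "filterlim w F sequentially"
    using F[of x w] xw(1) by auto
  \<comment> \<open>Outside the half-line \<open>\<phi>\<close> is arbitrary; extending by zero makes it measurable on the whole line.\<close>
  define f where "f t = (if t \<in> {0<..} then \<phi> t else 0)" for t
  have f_meas: "f \<in> borel_measurable lebesgue"
    unfolding f_def by (rule borel_measurable_if_I[OF meas]) auto
  have xp: "x n > 0" and wp: "w n > 0" for n using xw(1)[of n] by auto
  have f_eq: "f t = \<phi> t" if "t > 0" for t using that by (simp add: f_def)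
  have "\<exists>n. f (w n) \<le> C * f (x n) \<and> f (x n) \<le> C * f (w n)"
    unfolding C
  proof (rule ratio_bounded_along_sequences[OF f_meas])
    show "(\<lambda>n. f (l * x n) / f (x n)) \<longlonglongrightarrow> l powr \<rho>" if "l > 0" for l
      using filterlim_compose[OF rv[OF that] lim(1)] that xp by (simp add: f_eq)
    show "(\<lambda>n. f (l * w n) / f (w n)) \<longlonglongrightarrow> l powr \<rho>" if "l > 0" for l
      using filterlim_compose[OF rv[OF that] lim(2)] that wp by (simp add: f_eq)
  qed (use xw pos f_eq in auto)
  then show False using xw(2) unfolding f_eq[OF xp] f_eq[OF wp] by blast
qed

text \<open>The two ends are covered by the uniform convergence theorem, and the compact range that is left by
boundedness of \<open>\<phi>\<close> above and away from zero.\<close>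
lemma doubling:
  fixes \<phi> :: "real \<Rightarrow> real"
  assumes meas: "\<phi> \<in> borel_measurable (lebesgue_on {0<..})"
    and pos: "\<And>t. t > 0 \<Longrightarrow> \<phi> t > 0"
    and rv0: "regularly_varying_at_zero \<phi> \<rho>_0"
    and rvi: "regularly_varying_at_infinity \<phi> \<rho>_inf"
    and bdd: "\<And>K. compact K \<Longrightarrow> K \<subseteq> {0<..} \<Longrightarrow>
           (\<exists>M. \<forall>t\<in>K. \<phi> t \<le> M) \<and> (\<exists>m>0. \<forall>t\<in>K. m \<le> \<phi> t)"
  obtains C where "C \<ge> 1" "\<And>s t. 0 < s \<Longrightarrow> 0 < t \<Longrightarrow> s \<le> 2 * t \<Longrightarrow> t \<le> 2 * s \<Longrightarrow> \<phi> s \<le> C * \<phi> t"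
proof -
  have "\<exists>n. \<forall>s t. s \<in> {real n..} \<longrightarrow> 0 < s \<longrightarrow> s \<le> t \<longrightarrow> t \<le> 2 * s \<longrightarrow>
          \<phi> t \<le> (2 * 4 powr \<bar>\<rho>_inf\<bar>)\<^sup>2 * \<phi> s \<and> \<phi> s \<le> (2 * 4 powr \<bar>\<rho>_inf\<bar>)\<^sup>2 * \<phi> t"
  proof (rule locally_uniform_doubling[where S = "\<lambda>n. {real n..}" and F = "at_top" and \<rho> = \<rho>_inf, OF meas pos _ refl])
    fix x w :: "nat \<Rightarrow> real"
    assume xw: "\<And>n. x n > 0 \<and> x n \<le> w n \<and> w n \<le> 2 * x n \<and> x n \<in> {real n..}"
    have "real n \<le> x n" "real n \<le> w n" for n
      using xw[of n] by auto
    then show "filterlim x at_top sequentially \<and> filterlim w at_top sequentially"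
      by (auto intro!: filterlim_at_top_mono[OF filterlim_real_sequentially])
  qed (use rvi in \<open>auto simp: regularly_varying_at_infinity_def\<close>)
  then obtain b where b: "\<And>s t. real b \<le> s \<Longrightarrow> 0 < s \<Longrightarrow> s \<le> t \<Longrightarrow> t \<le> 2 * s \<Longrightarrow>
      \<phi> t \<le> (2 * 4 powr \<bar>\<rho>_inf\<bar>)\<^sup>2 * \<phi> s \<and> \<phi> s \<le> (2 * 4 powr \<bar>\<rho>_inf\<bar>)\<^sup>2 * \<phi> t"
    by auto
  have "\<exists>n. \<forall>s t. s \<in> {..1 / Suc n} \<longrightarrow> 0 < s \<longrightarrow> s \<le> t \<longrightarrow> t \<le> 2 * s \<longrightarrow>
          \<phi> t \<le> (2 * 4 powr \<bar>\<rho>_0\<bar>)\<^sup>2 * \<phi> s \<and> \<phi> s \<le> (2 * 4 powr \<bar>\<rho>_0\<bar>)\<^sup>2 * \<phi> t"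
  proof (rule locally_uniform_doubling[where S = "\<lambda>n. {..1 / real (Suc n)}" and F = "at_right 0" and \<rho> = \<rho>_0, OF meas pos _ refl])
    fix x w :: "nat \<Rightarrow> real"
    assume a: "\<And>n. x n > 0 \<and> x n \<le> w n \<and> w n \<le> 2 * x n \<and> x n \<in> {..1 / Suc n}"
    have lim: "(\<lambda>n. 2 * (1 / real (Suc n))) \<longlonglongrightarrow> 0"
      using tendsto_mult_right_zero[OF LIMSEQ_inverse_real_of_nat, of 2] by (simp add: field_simps)
    have squeeze: "z \<longlonglongrightarrow> 0" if "\<And>n. 0 < z n \<and> z n \<le> 2 * (1 / real (Suc n))" for z :: "nat \<Rightarrow> real"
      by (rule tendsto_sandwich[OF _ _ tendsto_const lim]; rule always_eventually; use that less_imp_le in blast)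
    have "0 < x n" "0 < w n" "x n \<le> 2 * (1 / real (Suc n))" "w n \<le> 2 * (1 / real (Suc n))" for n
      using a[of n] by auto
    then have "x \<longlonglongrightarrow> 0" "w \<longlonglongrightarrow> 0" "\<And>n. 0 < x n" "\<And>n. 0 < w n"
      using squeeze by blast+
    then show "filterlim x (at_right 0) sequentially \<and> filterlim w (at_right 0) sequentially"
      by (auto intro!: tendsto_imp_filterlim_at_right always_eventually)
  qed (use rv0 in \<open>auto simp: regularly_varying_at_zero_def\<close>)
  then obtain a where a: "\<And>s t. s \<le> 1 / Suc a \<Longrightarrow> 0 < s \<Longrightarrow> s \<le> t \<Longrightarrow> t \<le> 2 * s \<Longrightarrow>
      \<phi> t \<le> (2 * 4 powr \<bar>\<rho>_0\<bar>)\<^sup>2 * \<phi> s \<and> \<phi> s \<le> (2 * 4 powr \<bar>\<rho>_0\<bar>)\<^sup>2 * \<phi> t"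
    by auto
  obtain M m where Mm: "m > 0" "\<And>t. t \<in> {1 / Suc a..2 * real b} \<Longrightarrow> m \<le> \<phi> t \<and> \<phi> t \<le> M"
    using bdd[of "{1 / Suc a..2 * real b}"]
    by (metis (no_types, lifting) atLeastAtMost_iff compact_Icc divide_pos_pos greaterThan_iff less_le_trans
        of_nat_0_less_iff subsetI zero_less_Suc zero_less_one)
  define C where "C = max 1 (max (M / m) (max ((2 * 4 powr \<bar>\<rho>_0\<bar>)\<^sup>2) ((2 * 4 powr \<bar>\<rho>_inf\<bar>)\<^sup>2)))"
  have C: "1 \<le> C" "M / m \<le> C" "(2 * 4 powr \<bar>\<rho>_0\<bar>)\<^sup>2 \<le> C" "(2 * 4 powr \<bar>\<rho>_inf\<bar>)\<^sup>2 \<le> C"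
    by (auto simp: C_def le_max_iff_disj)
  have ordered: "\<phi> t \<le> C * \<phi> s \<and> \<phi> s \<le> C * \<phi> t" if st: "0 < s" "s \<le> t" "t \<le> 2 * s" for s t
  proof -
    have p: "\<phi> s > 0" "\<phi> t > 0" using st pos by auto
    have weaken: "\<phi> t \<le> C * \<phi> s \<and> \<phi> s \<le> C * \<phi> t" if "D \<le> C" "\<phi> t \<le> D * \<phi> s \<and> \<phi> s \<le> D * \<phi> t" for D
      using that mult_right_mono[OF that(1), of "\<phi> s"] mult_right_mono[OF that(1), of "\<phi> t"] p by linarith
    consider "s \<le> 1 / Suc a" | "real b \<le> s" | "1 / Suc a \<le> s" "s \<le> real b" by linarith
    then show ?thesis
    proof cases
      case 1 then show ?thesis using a[OF _ st] C weaken by blast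
    next
      case 2 then show ?thesis using b[OF _ st] C weaken by blast
    next
      case 3
      then have "m \<le> \<phi> s" "\<phi> s \<le> M" "m \<le> \<phi> t" "\<phi> t \<le> M" using Mm(2)[of s] Mm(2)[of t] st by auto
      moreover have "M \<le> (M / m) * r" if "m \<le> r" "m \<le> M" for r
        using mult_left_mono[OF that(1), of "M / m"] that(2) Mm(1) by simp
      ultimately have "\<phi> t \<le> (M / m) * \<phi> s \<and> \<phi> s \<le> (M / m) * \<phi> t"
        by (meson order_trans)
      then show ?thesis using C weaken by blast
    qed
  qed
  show thesis
  proof (rule that[of C])
    fix s t :: real
    assume "0 < s" "0 < t" "s \<le> 2 * t" "t \<le> 2 * s"
    then show "\<phi> s \<le> C * \<phi> t"
      using ordered[of s t] ordered[of t s] by (cases "s \<le> t") auto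
  qed (rule C(1))
qed

lemma doubling_iterated:
  fixes \<phi> :: "real \<Rightarrow> real"
  assumes C: "C \<ge> 1"
    and dbl: "\<And>s t. 0 < s \<Longrightarrow> 0 < t \<Longrightarrow> s \<le> 2 * t \<Longrightarrow> t \<le> 2 * s \<Longrightarrow> \<phi> s \<le> C * \<phi> t"
  shows "0 < s \<Longrightarrow> 0 < t \<Longrightarrow> s \<le> 2 ^ Suc k * t \<Longrightarrow> t \<le> 2 ^ Suc k * s \<Longrightarrow> \<phi> s \<le> C ^ Suc k * \<phi> t"
proof (induction k arbitrary: t)
  case (Suc k)
  \<comment> \<open>Clamping \<open>t\<close> to the smaller range around \<open>s\<close> gives an intermediate point within a factor 2 of \<open>t\<close>.\<close>
  define r where "r = max (s / 2 ^ Suc k) (min t (2 ^ Suc k * s))"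
  have two: "(2::real) ^ Suc k \<ge> 1" by (rule one_le_power) simp
  have "s / 2 ^ Suc k \<le> s" using two Suc.prems by (simp add: field_simps)
  moreover have "s \<le> 2 ^ Suc k * s" using two Suc.prems by simp
  ultimately have r: "s / 2 ^ Suc k \<le> r" "r \<le> 2 ^ Suc k * s" by (auto simp: r_def)
  have rp: "r > 0" using Suc.prems by (simp add: r_def less_max_iff_disj)
  have "\<phi> s \<le> C ^ Suc k * \<phi> r"
    using r rp Suc.prems by (intro Suc.IH) (auto simp: field_simps)
  also have "\<phi> r \<le> C * \<phi> t"
  proof (rule dbl)
    have "s / 2 ^ Suc k \<le> 2 * t" "t \<le> 2 * (2 ^ Suc k * s)"
      using Suc.prems by (auto simp: field_simps)
    then show "r \<le> 2 * t" "t \<le> 2 * r" using Suc.prems by (auto simp: r_def max_def min_def)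
  qed (use rp Suc.prems in auto)
  finally show ?case using C by (simp add: mult_ac)
qed (use dbl in simp)

section \<open>Potter type bounds for dilations\<close>

text \<open>A Potter type bound. An orbit \<open>t, 2 * t, 4 * t, \<dots>\<close> visits the range \<open>{a..b}\<close> only boundedly many times, so the
steps on which \<open>h\<close> may grow cost at most a constant factor. The count is encoded in a weight: \<open>L t\<close> is the
logarithmic position of \<open>t\<close> within the range, clipped to \<open>{0..N}\<close>. It gains 1 on each step that starts there, so
\<open>h t * \<theta> powr L t\<close> contracts by \<open>q\<close> on every step while remaining comparable to \<open>h\<close>.\<close>
lemma geometric_decay_of_dyadic_ratios:
  fixes h :: "real \<Rightarrow> real"
  assumes pos: "\<And>t. t > 0 \<Longrightarrow> h t > 0"
    and q: "0 < q" "q < 1" and a: "0 < a" "a \<le> b"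
    and small: "\<And>t. 0 < t \<Longrightarrow> t < a \<Longrightarrow> h (2 * t) \<le> q * h t"
    and large: "\<And>t. b < t \<Longrightarrow> h (2 * t) \<le> q * h t"
    and all: "\<And>t. 0 < t \<Longrightarrow> h (2 * t) \<le> C * h t"
  obtains K where "K > 0" "\<And>n t. 0 < t \<Longrightarrow> h (2 ^ n * t) \<le> K * q ^ n * h t"
proof -
  define D where "D = max C 1"
  have D_ge: "D \<ge> 1" by (simp add: D_def)
  have D: "h (2 * t) \<le> D * h t" if t: "0 < t" for t
  proof -
    have "C * h t \<le> D * h t" using pos[OF t] by (intro mult_right_mono) (auto simp: D_def)
    then show ?thesis using all[OF t] by linarith
  qed
  \<comment> \<open>The extra 1 keeps the clipping from acting on a step that starts in \<open>{a..b}\<close> and ends beyond \<open>b\<close>.\<close>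
  define N where "N = log 2 (b / a) + 1"
  have N: "N \<ge> 1" using a by (simp add: N_def)
  define L where "L t = max 0 (min (log 2 (t / a)) N)" for t
  define \<theta> where "\<theta> = q / D"
  have \<theta>: "0 < \<theta>" "\<theta> \<le> 1" using q D_ge by (auto simp: \<theta>_def field_simps)
  have L_bounds: "0 \<le> L t" "L t \<le> N" for t using N by (auto simp: L_def)
  have step_log: "log 2 (2 * t / a) = log 2 (t / a) + 1" if "t > 0" for t
    using that a log_mult[of 2 "t / a" 2] by (simp add: mult.commute)
  have L_mono: "L t \<le> L (2 * t)" if "t > 0" for t
    using step_log[OF that] by (auto simp: L_def)
  have L_step: "L (2 * t) = L t + 1" if "a \<le> t" "t \<le> b" for t
  proof -
    have "log 2 (t / a) \<ge> 0" "log 2 (t / a) + 1 \<le> N" using that a by (auto simp: N_def divide_right_mono)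
    then show ?thesis using step_log[of t] that a by (simp add: L_def)
  qed
  define G where "G t = h t * \<theta> powr L t" for t
  have G_step: "G (2 * t) \<le> q * G t" if t: "t > 0" for t
  proof (cases "a \<le> t \<and> t \<le> b")
    case True
    have "G (2 * t) = h (2 * t) * (\<theta> * \<theta> powr L t)"
      using L_step True \<theta> by (simp add: G_def powr_add)
    also have "\<dots> \<le> D * h t * (\<theta> * \<theta> powr L t)"
      using D[OF t] \<theta> by (intro mult_right_mono) auto
    also have "\<dots> = q * G t" using D_ge by (simp add: G_def \<theta>_def)
    finally show ?thesis .
  next
    case False
    then have "h (2 * t) \<le> q * h t" using small[of t] large[of t] t by linarith
    moreover have "\<theta> powr L (2 * t) \<le> \<theta> powr L t" using \<theta> L_mono[OF t] by (intro powr_mono') auto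
    ultimately have "h (2 * t) * \<theta> powr L (2 * t) \<le> (q * h t) * \<theta> powr L t"
      using pos[OF t] q by (intro mult_mono) auto
    then show ?thesis by (simp add: G_def mult.assoc)
  qed
  have G_iter: "G (2 ^ n * t) \<le> q ^ n * G t" if t: "t > 0" for n t
  proof (induction n)
    case (Suc n)
    have "G (2 * (2 ^ n * t)) \<le> q * G (2 ^ n * t)" by (rule G_step) (use t in simp)
    also have "\<dots> \<le> q * (q ^ n * G t)" using Suc q by simp
    finally show ?case by (simp add: mult.assoc)
  qed simp
  have below: "\<theta> powr N * h t \<le> G t" "G t \<le> h t" if t: "t > 0" for t
  proof -
    have "\<theta> powr N \<le> \<theta> powr L t" using \<theta> L_bounds by (intro powr_mono') auto
    then show "\<theta> powr N * h t \<le> G t" using pos[OF t] by (simp add: G_def)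
    have "\<theta> powr L t \<le> \<theta> powr 0" using \<theta> L_bounds by (intro powr_mono') auto
    then have "\<theta> powr L t \<le> 1" using \<theta> by simp
    then show "G t \<le> h t" using pos[OF t] by (simp add: G_def mult_left_le)
  qed
  show thesis
  proof (rule that[of "1 / \<theta> powr N"])
    show "1 / \<theta> powr N > 0" using \<theta> by simp
    fix n t assume t: "(t::real) > 0"
    have "\<theta> powr N * h (2 ^ n * t) \<le> G (2 ^ n * t)" by (rule below) (use t in simp)
    also have "\<dots> \<le> q ^ n * G t" by (rule G_iter[OF t])
    also have "\<dots> \<le> q ^ n * h t" using below(2)[OF t] q by simp
    finally show "h (2 ^ n * t) \<le> 1 / \<theta> powr N * q ^ n * h t"
      using \<theta> by (simp add: field_simps)
  qed
qed

lemma geometric_decay: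
  fixes h :: "real \<Rightarrow> real"
  assumes pos: "\<And>t. t > 0 \<Longrightarrow> h t > 0"
    and all: "\<And>t. 0 < t \<Longrightarrow> h (2 * t) \<le> C * h t"
    and lim0: "((\<lambda>t. h (2 * t) / h t) \<longlongrightarrow> L0) (at_right 0)" "L0 < 1"
    and limi: "((\<lambda>t. h (2 * t) / h t) \<longlongrightarrow> Li) at_top" "Li < 1"
  obtains K q where "K > 0" "0 < q" "q < 1" "\<And>n t. 0 < t \<Longrightarrow> h (2 ^ n * t) \<le> K * q ^ n * h t"
proof -
  define q where "q = (max 0 (max L0 Li) + 1) / 2"
  have q: "0 < q" "q < 1" "L0 < q" "Li < q" using lim0(2) limi(2) by (auto simp: q_def max_def)
  obtain a where a: "a > 0" "\<And>t. 0 < t \<Longrightarrow> t < a \<Longrightarrow> h (2 * t) / h t < q"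
    using order_tendstoD(2)[OF lim0(1) q(3)] by (auto simp: eventually_at_right_field)
  obtain b where b: "\<And>t. b \<le> t \<Longrightarrow> h (2 * t) / h t < q"
    using order_tendstoD(2)[OF limi(1) q(4)] by (auto simp: eventually_at_top_linorder)
  have bound: "h (2 * t) \<le> q * h t" if "t > 0" "h (2 * t) / h t < q" for t
    using that pos[of t] by (simp add: field_simps)
  obtain K where "K > 0" "\<And>n t. 0 < t \<Longrightarrow> h (2 ^ n * t) \<le> K * q ^ n * h t"
  proof (rule geometric_decay_of_dyadic_ratios[of h q a "max a b" C])
    show "h (2 * t) \<le> q * h t" if "max a b < t" for t
      using that a(1) by (intro bound b) auto
  qed (use pos q a all bound in auto)
  then show thesis using that q by blast
qed

text \<open>The numerical heart of the dichotomy between the indices. With \<open>g t = \<phi> t / t ^ d\<close>, the claim is that \<open>g (l * t)\<close> is at most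
\<open>\<delta> * g t\<close> uniformly in \<open>t\<close>. If both indices are below \<open>d\<close>, then \<open>g\<close> varies with negative index at both ends
and large dilations make it small; if both exceed \<open>d\<close>, small dilations do. With one index on each side and small \<open>\<delta>\<close>, no single \<open>R\<close>
would work at both ends.\<close>
lemma small_dilation_ratio:
  fixes \<phi> :: "real \<Rightarrow> real"
  assumes pos: "\<And>t. t > 0 \<Longrightarrow> \<phi> t > 0"
    and C: "C \<ge> 1"
    and dbl: "\<And>s t. 0 < s \<Longrightarrow> 0 < t \<Longrightarrow> s \<le> 2 * t \<Longrightarrow> t \<le> 2 * s \<Longrightarrow> \<phi> s \<le> C * \<phi> t"
    and rv0: "regularly_varying_at_zero \<phi> \<rho>_0"
    and rvi: "regularly_varying_at_infinity \<phi> \<rho>_inf"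
    and index: "(\<rho>_0 < real d \<and> \<rho>_inf < real d) \<or> (\<rho>_0 > real d \<and> \<rho>_inf > real d)"
    and \<delta>: "\<delta> > 0"
  obtains R where "R \<ge> 2 \<or> (0 < R \<and> R \<le> 1/4)"
    "\<And>l t. 0 < t \<Longrightarrow> R \<le> l \<Longrightarrow> l \<le> 2 * R \<Longrightarrow> \<phi> (l * t) \<le> \<delta> * l ^ d * \<phi> t"
proof -
  obtain r K q where r: "r = 2 \<or> r = 1 / (2::real)" and K: "K > 0" "0 < q" "q < 1"
    and decay: "\<And>n t. 0 < t \<Longrightarrow> \<phi> (r ^ n * t) \<le> K * q ^ n * (r ^ n) ^ d * \<phi> t"
    using index
  proof
    assume i: "\<rho>_0 < real d \<and> \<rho>_inf < real d"
    define h where "h t = \<phi> t / t ^ d" for t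
    have ratio: "h (2 * t) / h t = (\<phi> (2 * t) / \<phi> t) / 2 ^ d" if "t > 0" for t
      using that pos[OF that] by (simp add: h_def power_mult_distrib field_simps)
    have lim: "((\<lambda>t. h (2 * t) / h t) \<longlongrightarrow> 2 powr (\<rho> - d)) F"
      if "((\<lambda>t. \<phi> (2 * t) / \<phi> t) \<longlongrightarrow> 2 powr \<rho>) F" "\<forall>\<^sub>F t in F. t > 0" for F and \<rho> :: real
    proof (rule Lim_transform_eventually)
      show "((\<lambda>t. (\<phi> (2 * t) / \<phi> t) / 2 ^ d) \<longlongrightarrow> 2 powr (\<rho> - d)) F"
        using tendsto_divide[OF that(1) tendsto_const[of "2 ^ d"]]
        by (simp add: powr_diff powr_realpow)
      show "\<forall>\<^sub>F t in F. (\<phi> (2 * t) / \<phi> t) / 2 ^ d = h (2 * t) / h t"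
        using that(2) by (rule eventually_mono) (simp add: ratio)
    qed
    obtain K q where Kq: "K > 0" "0 < q" "q < 1" "\<And>n t. 0 < t \<Longrightarrow> h (2 ^ n * t) \<le> K * q ^ n * h t"
    proof (rule geometric_decay[of h C])
      show "h t > 0" if "t > 0" for t using that pos by (simp add: h_def)
      show "h (2 * t) \<le> C * h t" if t: "t > 0" for t
      proof -
        have "\<phi> (2 * t) / (2 * t) ^ d \<le> \<phi> (2 * t) / t ^ d"
          using t pos[of "2 * t"] by (intro divide_left_mono power_mono) auto
        also have "\<dots> \<le> (C * \<phi> t) / t ^ d" using dbl[of "2 * t" t] t by (intro divide_right_mono) auto
        finally show ?thesis by (simp add: h_def)
      qed
      show "((\<lambda>t. h (2 * t) / h t) \<longlongrightarrow> 2 powr (\<rho>_0 - d)) (at_right 0)"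
        using rv0 by (intro lim) (auto simp: regularly_varying_at_zero_def eventually_at_right_less)
      show "((\<lambda>t. h (2 * t) / h t) \<longlongrightarrow> 2 powr (\<rho>_inf - d)) at_top"
        using rvi by (intro lim) (auto simp: regularly_varying_at_infinity_def eventually_gt_at_top)
    qed (use i in \<open>auto simp: powr_less_one\<close>)
    show thesis
    proof (rule that[of 2 K q])
      fix n t assume "(t::real) > 0"
      then show "\<phi> (2 ^ n * t) \<le> K * q ^ n * (2 ^ n) ^ d * \<phi> t"
        using Kq(4)[of t n] by (simp add: h_def power_mult_distrib field_simps)
    qed (use Kq in auto)
  next
    assume i: "\<rho>_0 > real d \<and> \<rho>_inf > real d"
    \<comment> \<open>Inverting the variable turns shrinking dilations into the doublings of the decay estimate.\<close>
    define h where "h t = \<phi> (1 / t) * t ^ d" for t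
    have ratio: "h (2 * t) / h t = (\<phi> (1/2 * (1 / t)) / \<phi> (1 / t)) * 2 ^ d" if "t > 0" for t
      using that pos[of "1 / t"] by (simp add: h_def power_mult_distrib field_simps)
    have lim: "((\<lambda>t. h (2 * t) / h t) \<longlongrightarrow> 2 powr (d - \<rho>)) G"
      if rv: "((\<lambda>t. \<phi> (1/2 * t) / \<phi> t) \<longlongrightarrow> (1/2) powr \<rho>) F"
        and F: "\<forall>\<^sub>F t in G. t > 0" "filterlim (\<lambda>t. 1 / t) F G" for F G and \<rho> :: real
    proof (rule Lim_transform_eventually)
      have "(1/2) powr \<rho> * 2 ^ d = 2 powr (d - \<rho>)"
        by (simp add: powr_diff powr_realpow powr_divide)
      then show "((\<lambda>t. (\<phi> (1/2 * (1 / t)) / \<phi> (1 / t)) * 2 ^ d) \<longlongrightarrow> 2 powr (d - \<rho>)) G"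
        using tendsto_mult[OF filterlim_compose[OF rv F(2)] tendsto_const[of "2 ^ d"]] by simp
      show "\<forall>\<^sub>F t in G. (\<phi> (1/2 * (1 / t)) / \<phi> (1 / t)) * 2 ^ d = h (2 * t) / h t"
        using F(1) by (rule eventually_mono) (simp add: ratio)
    qed
    obtain K q where Kq: "K > 0" "0 < q" "q < 1" "\<And>n t. 0 < t \<Longrightarrow> h (2 ^ n * t) \<le> K * q ^ n * h t"
    proof (rule geometric_decay[of h "C * 2 ^ d"])
      show "h t > 0" if "t > 0" for t using that pos by (simp add: h_def)
      show "h (2 * t) \<le> C * 2 ^ d * h t" if t: "t > 0" for t
        using dbl[of "1 / (2 * t)" "1 / t"] t by (simp add: h_def power_mult_distrib field_simps)
      show "((\<lambda>t. h (2 * t) / h t) \<longlongrightarrow> 2 powr (d - \<rho>_inf)) (at_right 0)"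
      proof (rule lim)
        show "((\<lambda>t. \<phi> (1/2 * t) / \<phi> t) \<longlongrightarrow> (1/2) powr \<rho>_inf) at_top"
          using rvi unfolding regularly_varying_at_infinity_def by (rule allE[of _ "1/2"]) simp
      qed (use filterlim_inverse_at_top_right in \<open>auto simp: eventually_at_right_less inverse_eq_divide\<close>)
      show "((\<lambda>t. h (2 * t) / h t) \<longlongrightarrow> 2 powr (d - \<rho>_0)) at_top"
      proof (rule lim)
        show "((\<lambda>t. \<phi> (1/2 * t) / \<phi> t) \<longlongrightarrow> (1/2) powr \<rho>_0) (at_right 0)"
          using rv0 unfolding regularly_varying_at_zero_def by (rule allE[of _ "1/2"]) simp
      qed (use filterlim_inverse_at_right_top in \<open>auto simp: eventually_gt_at_top inverse_eq_divide\<close>)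
    qed (use i in \<open>auto simp: powr_less_one\<close>)
    show thesis
    proof (rule that[of "1/2" K q])
      fix n t assume "(t::real) > 0"
      then show "\<phi> ((1/2) ^ n * t) \<le> K * q ^ n * ((1/2) ^ n) ^ d * \<phi> t"
        using Kq(4)[of "1 / t" n] by (simp add: h_def power_mult_distrib power_divide field_simps)
    qed (use Kq in auto)
  qed
  \<comment> \<open>The factor \<open>C\<close> pays for passing from the dyadic dilation \<open>r ^ n\<close> to all \<open>l\<close> between \<open>r ^ n\<close> and \<open>2 * r ^ n\<close>.\<close>
  have "(\<lambda>n. C * K * q ^ n) \<longlonglongrightarrow> C * K * 0"
    using K by (intro tendsto_intros LIMSEQ_power_zero) auto
  then have "\<forall>\<^sub>F n in sequentially. C * K * q ^ n < \<delta> \<and> n \<ge> 2"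
    using \<delta> by (intro eventually_conj order_tendstoD eventually_ge_at_top) auto
  then obtain n where n: "C * K * q ^ n < \<delta>" "n \<ge> 2"
    by (auto simp: eventually_sequentially)
  have rp: "r > 0" using r by auto
  show thesis
  proof (rule that[of "r ^ n"])
    have "(2::real) ^ 2 \<le> 2 ^ n" using n by (intro power_increasing) auto
    then have four: "(4::real) \<le> 2 ^ n" by simp
    have "1 / 2 ^ n \<le> 1 / (4::real)" using four by (intro divide_left_mono) auto
    then have "(1/2::real) ^ n \<le> 1/4" by (simp add: power_divide)
    moreover have "(2::real) ^ n \<ge> 2" using four by linarith
    ultimately show "r ^ n \<ge> 2 \<or> (0 < r ^ n \<and> r ^ n \<le> 1/4)"
      using r zero_less_power[OF rp, of n] by metis
  next
    fix l t :: real assume t: "0 < t" and l: "r ^ n \<le> l" "l \<le> 2 * r ^ n"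
    have l0: "0 < l" using l rp by (meson less_le_trans zero_less_power)
    have "\<phi> (l * t) \<le> C * \<phi> (r ^ n * t)"
    proof (rule dbl)
      show "l * t \<le> 2 * (r ^ n * t)" using l t by (simp add: mult.assoc[symmetric])
      have "r ^ n * t \<le> l * t" using l t by simp
      also have "\<dots> \<le> 2 * (l * t)" using l0 t by simp
      finally show "r ^ n * t \<le> 2 * (l * t)" .
    qed (use l0 t rp in auto)
    also have "\<dots> \<le> C * (K * q ^ n * (r ^ n) ^ d * \<phi> t)"
      using C decay[OF t, of n] by (intro mult_left_mono) auto
    also have "\<dots> = (C * K * q ^ n) * ((r ^ n) ^ d * \<phi> t)" by (simp add: mult_ac)
    also have "\<dots> \<le> \<delta> * (l ^ d * \<phi> t)"
      using n(1) l rp \<delta> pos[OF t] by (intro mult_mono power_mono mult_nonneg_nonneg) auto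
    finally show "\<phi> (l * t) \<le> \<delta> * l ^ d * \<phi> t" by (simp add: mult_ac)
  qed
qed

text \<open>Replacing \<open>\<phi>\<close> by its value at the largest power of two not exceeding the argument gives a comparable function that is Borel. This matters
because \<open>\<phi> (norm (x - y))\<close>, with \<open>\<phi>\<close> merely Lebesgue measurable, need not be measurable for the product of two
Lebesgue sigma-algebras, as Fubini requires.\<close>
lemma borel_comparable:
  fixes \<phi> :: "real \<Rightarrow> real"
  assumes dbl: "\<And>s t. 0 < s \<Longrightarrow> 0 < t \<Longrightarrow> s \<le> 2 * t \<Longrightarrow> t \<le> 2 * s \<Longrightarrow> \<phi> s \<le> C * \<phi> t"
    and pos: "\<And>t. t > 0 \<Longrightarrow> \<phi> t > 0"
  obtains \<psi> :: "real \<Rightarrow> real" where "\<psi> \<in> borel_measurable borel" "\<And>t. t > 0 \<Longrightarrow> \<psi> t > 0"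
    "\<And>t. t > 0 \<Longrightarrow> \<psi> t \<le> C * \<phi> t" "\<And>t. t > 0 \<Longrightarrow> \<phi> t \<le> C * \<psi> t"
proof -
  define D where "D t = 2 powr real_of_int \<lfloor>log 2 t\<rfloor>" for t :: real
  have D: "0 < D t" "D t \<le> t" "t \<le> 2 * D t" if "t > 0" for t
  proof -
    have "D t \<le> 2 powr (log 2 t)" unfolding D_def by (intro powr_mono) auto
    then show "D t \<le> t" using that by simp
    have "2 powr (log 2 t) \<le> 2 powr (1 + real_of_int \<lfloor>log 2 t\<rfloor>)" by (intro powr_mono) linarith+
    then show "t \<le> 2 * D t" using that by (simp add: D_def powr_add)
  qed (simp add: D_def)
  have "(\<lambda>k. \<phi> (2 powr real_of_int k)) \<in> count_space UNIV \<rightarrow>\<^sub>M (borel :: real measure)" by simp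
  moreover have "(\<lambda>t. \<lfloor>log 2 t\<rfloor>) \<in> borel \<rightarrow>\<^sub>M count_space UNIV" by measurable
  ultimately have "(\<lambda>t. \<phi> (D t)) \<in> borel_measurable borel"
    unfolding D_def by (rule measurable_compose[rotated])
  then show thesis
  proof (rule that)
    fix t :: real assume t: "t > 0"
    show "\<phi> (D t) > 0" by (rule pos[OF D(1)[OF t]])
    show "\<phi> (D t) \<le> C * \<phi> t" "\<phi> t \<le> C * \<phi> (D t)"
      using D[OF t] t by (auto intro: dbl)
  qed
qed

section \<open>Averaging over annuli\<close>

lemma sigma_finite_lebesgue: "sigma_finite_measure (lebesgue :: 'a::euclidean_space measure)"
proof
  obtain A :: "'a set set" where "countable A" "A \<subseteq> sets lborel" "\<Union>A = space lborel"
      "\<forall>a\<in>A. emeasure lborel a \<noteq> \<infinity>"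
    using lborel.sigma_finite_countable by blast
  then show "\<exists>A :: 'a set set. countable A \<and> A \<subseteq> sets lebesgue \<and> \<Union>A = space lebesgue \<and>
      (\<forall>a\<in>A. emeasure lebesgue a \<noteq> \<infinity>)"
    by (intro exI[of _ A]) (auto simp: subset_iff)
qed

lemma emeasure_annulus:
  assumes r: "r > 0"
  shows "emeasure lebesgue {y :: 'a::euclidean_space. r \<le> norm y \<and> norm y \<le> 2 * r}
     = ennreal (unit_ball_vol DIM('a) * (2 ^ DIM('a) - 1) * r ^ DIM('a))"
proof -
  have "{y :: 'a. r \<le> norm y \<and> norm y \<le> 2 * r} = cball 0 (2 * r) - ball 0 r" by auto
  moreover have "emeasure lborel (cball 0 (2 * r) - ball 0 r :: 'a set)
      = emeasure lborel (cball 0 (2 * r) :: 'a set) - emeasure lborel (ball 0 r :: 'a set)"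
    using r by (intro emeasure_Diff) (auto simp: emeasure_ball)
  moreover have "\<dots> = ennreal (unit_ball_vol DIM('a) * (2 * r) ^ DIM('a) - unit_ball_vol DIM('a) * r ^ DIM('a))"
    using r by (simp add: emeasure_ball emeasure_cball ennreal_minus)
  moreover have "\<dots> = ennreal (unit_ball_vol DIM('a) * (2 ^ DIM('a) - 1) * r ^ DIM('a))"
    by (simp add: power_mult_distrib algebra_simps)
  ultimately show ?thesis by simp
qed

lemma powr_abs_triangle:
  fixes a b p :: real
  assumes p: "p > 0"
  shows "\<bar>a\<bar> powr p \<le> 2 powr p * (\<bar>a - b\<bar> powr p + \<bar>b\<bar> powr p)"
proof -
  define m where "m = max \<bar>a - b\<bar> \<bar>b\<bar>"
  have "\<bar>a - b\<bar> \<le> m" "\<bar>b\<bar> \<le> m" by (simp_all add: m_def)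
  then have "\<bar>a\<bar> \<le> 2 * m" by linarith
  then have "\<bar>a\<bar> powr p \<le> (2 * m) powr p" using p by (intro powr_mono2) auto
  also have "\<dots> = 2 powr p * m powr p" by (rule powr_mult)
  also have "m powr p \<le> \<bar>a - b\<bar> powr p + \<bar>b\<bar> powr p" by (auto simp: m_def max_def)
  finally show ?thesis by (simp add: mult_left_mono)
qed

text \<open>Only the smaller function has to be measurable: its constant is moved across the integral, and the larger side is
used through monotonicity alone.\<close>
lemma nn_integral_le_cmult:
  assumes f [measurable]: "f \<in> borel_measurable M" and c: "(c::real) > 0"
    and le: "\<And>x. f x \<le> ennreal c * g x"
  shows "(\<integral>\<^sup>+x. f x \<partial>M) \<le> ennreal c * (\<integral>\<^sup>+x. g x \<partial>M)"
proof -
  have cancel: "ennreal c * (ennreal (1 / c) * z) = z" "ennreal (1 / c) * (ennreal c * z) = z" for z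
    using c by (simp_all add: mult.assoc[symmetric] ennreal_mult[symmetric])
  have "(\<integral>\<^sup>+x. f x \<partial>M) = ennreal c * (ennreal (1 / c) * (\<integral>\<^sup>+x. f x \<partial>M))"
    by (simp only: cancel)
  also have "ennreal (1 / c) * (\<integral>\<^sup>+x. f x \<partial>M) = (\<integral>\<^sup>+x. ennreal (1 / c) * f x \<partial>M)"
    by (rule nn_integral_cmult[symmetric]) measurable
  also have "\<dots> \<le> (\<integral>\<^sup>+x. g x \<partial>M)"
  proof (rule nn_integral_mono)
    show "ennreal (1 / c) * f x \<le> g x" for x
      using mult_left_mono[OF le[of x], of "ennreal (1 / c)"] by (simp only: cancel zero_le)
  qed
  finally show ?thesis by (simp add: mult_left_mono)
qed

text \<open>For fixed \<open>x\<close>, split \<open>\<bar>u x\<bar> powr p\<close> into a difference term and a term in \<open>u y\<close>, average over \<open>y\<close> in the annulus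
\<open>R * norm x \<le> norm y \<le> 2 * R * norm x\<close> of volume \<open>v R * norm x ^ d\<close>, and integrate against \<open>1 / \<psi> (norm x)\<close>. After
interchanging the integrals, the second term is \<open>\<bar>u y\<bar> powr p / \<psi> (norm y)\<close> times the average of
\<open>(\<psi> (norm y) / \<psi> (norm x)) / (norm y / norm x) ^ d\<close>, up to a factor at most \<open>2 ^ d * 2 powr p\<close>. The dilation hypothesis makes
this at most half of the left-hand side, which is absorbed since it is finite. The kernel \<open>T\<close> is any majorant of the
difference quotient on the annuli and need not be measurable.\<close>
lemma hardy_by_averaging:
  fixes u :: "'a::euclidean_space \<Rightarrow> real" and \<psi> :: "real \<Rightarrow> real" and p R \<delta> \<kappa> :: real
    and T :: "'a \<Rightarrow> 'a \<Rightarrow> ennreal"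
  defines "v \<equiv> \<lambda>r :: real. unit_ball_vol DIM('a) * (2 ^ DIM('a) - 1) * r ^ DIM('a)"
  defines "I \<equiv> \<integral>\<^sup>+x\<in>UNIV - {0}. ennreal (\<bar>u x\<bar> powr p / \<psi> (norm x)) \<partial>lebesgue"
  assumes p: "p > 0" and R: "R > 0"
    and \<psi>_meas [measurable]: "\<psi> \<in> borel_measurable borel"
    and pos: "\<And>t. t > 0 \<Longrightarrow> \<psi> t > 0"
    and dilation: "\<And>l t. 0 < t \<Longrightarrow> R \<le> l \<Longrightarrow> l \<le> 2 * R \<Longrightarrow> \<psi> (l * t) \<le> \<delta> * l ^ DIM('a) * \<psi> t"
    and \<delta>: "0 \<le> \<delta>" "2 powr p * 2 ^ DIM('a) * \<delta> \<le> 1/2"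
    and u [measurable]: "u \<in> borel_measurable lebesgue"
    and fin: "I < \<infinity>"
    and \<kappa>: "\<kappa> > 0"
    and T: "\<And>x y. x \<noteq> 0 \<Longrightarrow> R * norm x \<le> norm y \<Longrightarrow> norm y \<le> 2 * (R * norm x) \<Longrightarrow>
      ennreal (\<bar>u x - u y\<bar> powr p / (\<psi> (norm x) * norm x ^ DIM('a))) \<le> ennreal \<kappa> * T x y"
  shows "I \<le> ennreal (2 * 2 powr p * \<kappa> / v R) * (\<integral>\<^sup>+x. (\<integral>\<^sup>+y. T x y \<partial>lebesgue) \<partial>lebesgue)"
proof -
  interpret pair_sigma_finite "lebesgue :: 'a measure" "lebesgue :: 'a measure"
    by (intro pair_sigma_finite.intro sigma_finite_lebesgue)
  define d where "d = DIM('a)"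
  have v: "v r = v 1 * r ^ d" for r by (simp add: v_def d_def)
  have d: "d \<ge> 1" by (simp add: d_def Suc_leI)
  have v1: "v 1 > 0" using d one_less_power[of "2::real" d] by (simp add: v_def d_def)
  have vR: "v R > 0" using v1 R v[of R] by simp
  define annulus where "annulus r = {y :: 'a. r \<le> norm y \<and> norm y \<le> 2 * r}" for r
  have vol: "emeasure lebesgue (annulus r) = ennreal (v r)" if "r > 0" for r
    using emeasure_annulus[OF that, where 'a = 'a] by (simp add: annulus_def v_def)
  have annulus_sets [measurable]: "annulus r \<in> sets lebesgue" for r
  proof -
    have "annulus r = cball 0 (2 * r) - ball 0 r" by (auto simp: annulus_def)
    then show ?thesis by simp
  qed
  have norm_meas [measurable]: "norm \<in> borel_measurable (lebesgue :: 'a measure)"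
    by (rule measurable_completion) simp
  define a where "a x = ennreal (\<bar>u x\<bar> powr p / \<psi> (norm x)) * indicator (UNIV - {0}) x" for x
  define E where "E = {(x, y :: 'a). x \<noteq> (0::'a) \<and> R * norm x \<le> norm y \<and> norm y \<le> 2 * (R * norm x)}"
  have E_iff: "(x, y) \<in> E \<longleftrightarrow> x \<noteq> 0 \<and> y \<in> annulus (R * norm x)" for x y
    by (simp add: E_def annulus_def)
  have [measurable]: "UNIV - {0 :: 'a} \<in> sets lebesgue"
    by (auto simp: Compl_eq[symmetric])
  have E_eq: "E = {z \<in> space (lebesgue \<Otimes>\<^sub>M lebesgue).
      norm (fst z) \<noteq> 0 \<and> R * norm (fst z) \<le> norm (snd z) \<and> norm (snd z) \<le> 2 * (R * norm (fst z))}"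
    by (auto simp: E_def space_pair_measure)
  have E_meas [measurable]: "E \<in> sets (lebesgue \<Otimes>\<^sub>M lebesgue)"
    unfolding E_eq by measurable
  have a_meas [measurable]: "a \<in> borel_measurable lebesgue"
    unfolding a_def by measurable
  have I_eq: "I = (\<integral>\<^sup>+x. a x \<partial>lebesgue)" by (simp add: I_def a_def)
  define G where "G x y = ennreal (2 powr p / v R) *
      (ennreal (\<bar>u x - u y\<bar> powr p / (\<psi> (norm x) * norm x ^ d)) * indicator E (x, y))" for x y
  define B where "B x y = ennreal (2 powr p / v R) *
      (ennreal (\<bar>u y\<bar> powr p / (\<psi> (norm x) * norm x ^ d)) * indicator E (x, y))" for x y
  have G_meas [measurable]: "case_prod G \<in> borel_measurable (lebesgue \<Otimes>\<^sub>M lebesgue)"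
    unfolding G_def by measurable
  have B_meas [measurable]: "case_prod B \<in> borel_measurable (lebesgue \<Otimes>\<^sub>M lebesgue)"
    unfolding B_def by measurable
  have average: "a x \<le> (\<integral>\<^sup>+y. G x y \<partial>lebesgue) + (\<integral>\<^sup>+y. B x y \<partial>lebesgue)" for x
  proof (cases "x = 0")
    case False
    define n where "n = norm x"
    have n: "n > 0" using False by (simp add: n_def)
    have vn: "v (R * n) = v R * n ^ d" by (simp add: v[of "R * n"] v[of R] power_mult_distrib)
    have w: "\<psi> n > 0" using pos n by simp
    have "a x = ennreal (\<bar>u x\<bar> powr p / \<psi> n / v (R * n)) * emeasure lebesgue (annulus (R * n))"
      using False n R vn vR w
      by (simp add: vol a_def n_def[symmetric] ennreal_mult[symmetric] del: emeasure_completion)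
    also have "\<dots> = (\<integral>\<^sup>+y. ennreal (\<bar>u x\<bar> powr p / \<psi> n / v (R * n)) * indicator (annulus (R * n)) y \<partial>lebesgue)"
      by (simp add: nn_integral_cmult_indicator del: emeasure_completion)
    also have "\<dots> \<le> (\<integral>\<^sup>+y. G x y + B x y \<partial>lebesgue)"
    proof (rule nn_integral_mono)
      fix y
      have "\<bar>u x\<bar> powr p / \<psi> n / v (R * n) \<le>
          2 powr p * (\<bar>u x - u y\<bar> powr p + \<bar>u y\<bar> powr p) / \<psi> n / v (R * n)"
        using powr_abs_triangle[OF p, of "u x" "u y"] w vn vR n
        by (intro divide_right_mono) auto
      also have "\<dots> = 2 powr p / v R * (\<bar>u x - u y\<bar> powr p / (\<psi> n * n ^ d))
          + 2 powr p / v R * (\<bar>u y\<bar> powr p / (\<psi> n * n ^ d))"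
        using w vR n by (simp add: vn field_simps)
      finally have "ennreal (\<bar>u x\<bar> powr p / \<psi> n / v (R * n)) \<le>
          ennreal (2 powr p / v R) * ennreal (\<bar>u x - u y\<bar> powr p / (\<psi> n * n ^ d))
          + ennreal (2 powr p / v R) * ennreal (\<bar>u y\<bar> powr p / (\<psi> n * n ^ d))"
        using w vR n by (simp add: ennreal_mult[symmetric] ennreal_plus[symmetric] ennreal_leI del: ennreal_plus)
      then show "ennreal (\<bar>u x\<bar> powr p / \<psi> n / v (R * n)) * indicator (annulus (R * n)) y \<le> G x y + B x y"
        using False by (simp add: G_def B_def E_iff n_def[symmetric] split: split_indicator)
    qed
    also have "\<dots> = (\<integral>\<^sup>+y. G x y \<partial>lebesgue) + (\<integral>\<^sup>+y. B x y \<partial>lebesgue)"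
      by (intro nn_integral_add) measurable
    finally show ?thesis .
  qed (simp add: a_def)
  \<comment> \<open>The points \<open>x\<close> whose annulus contains \<open>y\<close> form an annulus around the origin with inner radius \<open>norm y / (2 * R)\<close>.\<close>
  have mass: "(\<integral>\<^sup>+x. B x y \<partial>lebesgue) \<le> ennreal (1/2) * a y" for y
  proof (cases "y = 0")
    case True
    have "indicator E (x, 0 :: 'a) = (0 :: ennreal)" for x using R by (auto simp: E_def indicator_def mult_le_0_iff)
    then show ?thesis using True by (simp add: B_def)
  next
    case False
    define n where "n = norm y"
    have n: "n > 0" using False by (simp add: n_def)
    have w: "\<psi> n > 0" using pos n by simp
    define s where "s = n / (2 * R)"
    have s: "s > 0" using n R by (simp add: s_def)
    define c where "c = 2 powr p / v R * (\<bar>u y\<bar> powr p * \<delta> * (n / s ^ 2) ^ d / \<psi> n)"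
    have c: "c \<ge> 0" using vR w n s \<delta> by (simp add: c_def)
    have "(\<integral>\<^sup>+x. B x y \<partial>lebesgue) \<le> (\<integral>\<^sup>+x. ennreal c * indicator (annulus s) x \<partial>lebesgue)"
    proof (rule nn_integral_mono)
      fix x :: 'a
      show "B x y \<le> ennreal c * indicator (annulus s) x"
      proof (cases "(x, y) \<in> E")
        case True
        define m where "m = norm x"
        have m: "m > 0" "R * m \<le> n" "n \<le> 2 * (R * m)" using True by (auto simp: E_def m_def n_def)
        have wm: "\<psi> m > 0" using pos m by simp
        have sm: "s \<le> m" "m \<le> 2 * s" using m R by (auto simp: s_def field_simps)
        have "\<psi> n = \<psi> (n / m * m)" using m by simp
        also have "\<dots> \<le> \<delta> * (n / m) ^ d * \<psi> m"
          unfolding d_def using m by (intro dilation) (auto simp: field_simps)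
        finally have "1 / \<psi> m \<le> \<delta> * (n / m) ^ d / \<psi> n"
          using w wm by (simp add: pos_le_divide_eq pos_divide_le_eq)
        then have "1 / (\<psi> m * m ^ d) \<le> \<delta> * (n / m) ^ d / \<psi> n / m ^ d"
          using m divide_right_mono[of "1 / \<psi> m" "\<delta> * (n / m) ^ d / \<psi> n" "m ^ d"] by simp
        also have "\<dots> = \<delta> * (n / m ^ 2) ^ d / \<psi> n"
          by (simp add: power_divide power2_eq_square power_mult_distrib)
        also have "\<dots> \<le> \<delta> * (n / s ^ 2) ^ d / \<psi> n"
          using \<delta> w n s sm
          by (intro divide_right_mono mult_left_mono power_mono divide_left_mono mult_pos_pos) auto
        finally have "1 / (\<psi> m * m ^ d) \<le> \<delta> * (n / s ^ 2) ^ d / \<psi> n" .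
        from mult_left_mono[OF this, of "2 powr p / v R * \<bar>u y\<bar> powr p"]
        have "2 powr p / v R * (\<bar>u y\<bar> powr p / (\<psi> m * m ^ d)) \<le> c"
          using vR by (simp add: c_def mult_ac)
        then have "ennreal (2 powr p / v R) * ennreal (\<bar>u y\<bar> powr p / (\<psi> m * m ^ d)) \<le> ennreal c"
          using vR wm m by (simp add: ennreal_mult[symmetric] ennreal_leI)
        then show ?thesis using True sm by (simp add: B_def annulus_def m_def[symmetric])
      qed (simp add: B_def)
    qed
    also have "\<dots> = ennreal (c * v s)"
      using c by (simp add: nn_integral_cmult_indicator vol[OF s] ennreal_mult' del: emeasure_completion)
    also have "c * v s = 2 powr p * 2 ^ d * \<delta> * (\<bar>u y\<bar> powr p / \<psi> n)"
    proof -
      have "(n / s ^ 2) ^ d * v s = (n / s) ^ d * v 1"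
        using s by (simp add: v[of s] power2_eq_square power_divide power_mult_distrib)
      also have "\<dots> = 2 ^ d * v R"
        using n R by (simp add: v[of R] s_def power_mult_distrib)
      finally have "(n / s ^ 2) ^ d * v s = 2 ^ d * v R" .
      moreover have "c * v s = 2 powr p / v R * (\<bar>u y\<bar> powr p * \<delta> / \<psi> n) * ((n / s ^ 2) ^ d * v s)"
        by (simp add: c_def mult_ac)
      ultimately show ?thesis using vR by (simp add: mult_ac)
    qed
    also have "ennreal \<dots> \<le> ennreal (1/2 * (\<bar>u y\<bar> powr p / \<psi> n))"
      using \<delta>(2) w by (intro ennreal_leI mult_right_mono) (auto simp: d_def)
    also have "\<dots> = ennreal (1/2) * ennreal (\<bar>u y\<bar> powr p / \<psi> n)"
      using w by (intro ennreal_mult) auto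
    also have "ennreal (\<bar>u y\<bar> powr p / \<psi> n) = a y"
      using False by (simp add: a_def n_def)
    finally show ?thesis .
  qed
  define J where "J = (\<integral>\<^sup>+x. (\<integral>\<^sup>+y. G x y \<partial>lebesgue) \<partial>lebesgue)"
  have "I \<le> (\<integral>\<^sup>+x. (\<integral>\<^sup>+y. G x y \<partial>lebesgue) + (\<integral>\<^sup>+y. B x y \<partial>lebesgue) \<partial>lebesgue)"
    unfolding I_eq by (intro nn_integral_mono average)
  also have "\<dots> = J + (\<integral>\<^sup>+x. (\<integral>\<^sup>+y. B x y \<partial>lebesgue) \<partial>lebesgue)"
    unfolding J_def by (intro nn_integral_add) measurable
  also have "(\<integral>\<^sup>+x. (\<integral>\<^sup>+y. B x y \<partial>lebesgue) \<partial>lebesgue) = (\<integral>\<^sup>+y. (\<integral>\<^sup>+x. B x y \<partial>lebesgue) \<partial>lebesgue)"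
    by (rule Fubini'[symmetric]) measurable
  also have "\<dots> \<le> (\<integral>\<^sup>+y. ennreal (1/2) * a y \<partial>lebesgue)"
    by (intro nn_integral_mono mass)
  also have "\<dots> = ennreal (1/2) * I"
    unfolding I_eq by (intro nn_integral_cmult) measurable
  finally have absorb: "I \<le> J + ennreal (1/2) * I" by (simp add: add_left_mono)
  have "I \<le> 2 * J"
  proof (cases J)
    case (real j)
    obtain i where i: "I = ennreal i" "i \<ge> 0" using fin by (cases I) auto
    have "J + ennreal (1/2) * I = ennreal (j + 1/2 * i)"
      unfolding real(2) i(1) using real(1) i(2) by (subst ennreal_mult[symmetric]) auto
    then have "ennreal i \<le> ennreal (j + 1/2 * i)" using absorb i(1) by simp
    then have "i \<le> j + 1/2 * i" using i(2) real(1) by (subst (asm) ennreal_le_iff) auto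
    then have "ennreal i \<le> ennreal (2 * j)" by (intro ennreal_leI) linarith
    also have "\<dots> = 2 * J" using real by (simp add: ennreal_mult)
    finally show ?thesis using i(1) by simp
  qed simp
  also have "2 * J \<le> 2 * (ennreal (2 powr p / v R * \<kappa>) * (\<integral>\<^sup>+x. (\<integral>\<^sup>+y. T x y \<partial>lebesgue) \<partial>lebesgue))"
    unfolding J_def
  proof (intro mult_left_mono nn_integral_le_cmult)
    fix x y
    show "G x y \<le> ennreal (2 powr p / v R * \<kappa>) * T x y"
    proof (cases "(x, y) \<in> E")
      case True
      then have "ennreal (\<bar>u x - u y\<bar> powr p / (\<psi> (norm x) * norm x ^ d)) \<le> ennreal \<kappa> * T x y"
        unfolding d_def by (intro T) (auto simp: E_def)
      then have "G x y \<le> ennreal (2 powr p / v R) * (ennreal \<kappa> * T x y)"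
        using True by (simp add: G_def mult_left_mono)
      moreover have "ennreal (2 powr p / v R * \<kappa>) = ennreal (2 powr p / v R) * ennreal \<kappa>"
        using \<kappa> vR by (intro ennreal_mult) auto
      ultimately show ?thesis by (simp only: mult.assoc)
    qed (simp add: G_def)
  qed (use \<kappa> vR in auto)
  finally show ?thesis
    using vR \<kappa> by (simp add: mult.assoc[symmetric] ennreal_mult'[symmetric] ennreal_numeral[symmetric]
        del: ennreal_numeral)
qed

section \<open>The Hardy inequality\<close>

theorem corollary2:
  fixes \<phi> :: "real \<Rightarrow> real" and \<rho>_0 \<rho>_inf p :: real
  assumes "0 < p"
    and "\<And>t. t > 0 \<Longrightarrow> \<phi> t > 0"
    and "\<phi> \<in> borel_measurable (lebesgue_on {0<..})"
    and "regularly_varying_at_zero \<phi> \<rho>_0"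
    and "regularly_varying_at_infinity \<phi> \<rho>_inf"
    and "\<And>K. compact K \<Longrightarrow> K \<subseteq> {0<..} \<Longrightarrow>
           (\<exists>M. \<forall>t\<in>K. \<phi> t \<le> M) \<and> (\<exists>m>0. \<forall>t\<in>K. m \<le> \<phi> t)"
    and "(0 < \<rho>_0 \<and> \<rho>_0 < real CARD('n::finite) \<and> 0 < \<rho>_inf \<and> \<rho>_inf < real CARD('n)) \<or>
         (\<rho>_0 > real CARD('n) \<and> \<rho>_inf > real CARD('n))"
  shows "\<exists>c::real. c > 0 \<and>
    (\<forall>u :: real ^ 'n \<Rightarrow> real. u \<in> borel_measurable lebesgue \<longrightarrow>
      (\<integral>\<^sup>+x\<in>UNIV - {0}. ennreal (\<bar>u x\<bar> powr p / \<phi> (norm x)) \<partial>lebesgue) < \<infinity> \<longrightarrow>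
      (\<integral>\<^sup>+x\<in>UNIV - {0}. ennreal (\<bar>u x\<bar> powr p / \<phi> (norm x)) \<partial>lebesgue)
        \<le> ennreal c *
          (\<integral>\<^sup>+x\<in>UNIV - {0}. (\<integral>\<^sup>+y\<in>UNIV - {0}.
             ennreal (\<bar>u x - u y\<bar> powr p / (\<phi> (norm (x - y)) * norm (x - y) ^ CARD('n)))
             \<partial>lebesgue) \<partial>lebesgue))"
proof -
  define d where "d = CARD('n)"
  have pos: "\<And>t. t > 0 \<Longrightarrow> \<phi> t > 0" by (rule assms(2))
  obtain C where C: "C \<ge> 1"
      and dbl: "\<And>s t. 0 < s \<Longrightarrow> 0 < t \<Longrightarrow> s \<le> 2 * t \<Longrightarrow> t \<le> 2 * s \<Longrightarrow> \<phi> s \<le> C * \<phi> t"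
    using doubling[OF assms(3) pos assms(4,5,6)] by blast
  obtain \<psi> :: "real \<Rightarrow> real" where \<psi>_meas: "\<psi> \<in> borel_measurable borel"
      and \<psi>_pos: "\<And>t. t > 0 \<Longrightarrow> \<psi> t > 0"
      and \<psi>_le: "\<And>t. t > 0 \<Longrightarrow> \<psi> t \<le> C * \<phi> t"
      and \<phi>_le: "\<And>t. t > 0 \<Longrightarrow> \<phi> t \<le> C * \<psi> t"
    using borel_comparable[of \<phi> C, OF dbl pos] by blast
  \<comment> \<open>The absorbed term gets the coefficient one half; the loss \<open>C\<^sup>2\<close> below comes from replacing \<open>\<phi>\<close> by \<open>\<psi>\<close> on both sides.\<close>
  define \<delta> where "\<delta> = 1 / (2 * (2 powr p * 2 ^ d))"
  have \<delta>: "\<delta> > 0" "2 powr p * 2 ^ d * \<delta> \<le> 1/2" by (auto simp: \<delta>_def)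
  have index: "(\<rho>_0 < real d \<and> \<rho>_inf < real d) \<or> (\<rho>_0 > real d \<and> \<rho>_inf > real d)"
    using assms(7) by (auto simp: d_def)
  have "\<delta> / C\<^sup>2 > 0" using \<delta> C by simp
  then obtain R where R_cases: "R \<ge> 2 \<or> (0 < R \<and> R \<le> 1/4)"
    and small: "\<And>l t. 0 < t \<Longrightarrow> R \<le> l \<Longrightarrow> l \<le> 2 * R \<Longrightarrow> \<phi> (l * t) \<le> \<delta> / C\<^sup>2 * l ^ d * \<phi> t"
    using small_dilation_ratio[of \<phi> C \<rho>_0 \<rho>_inf d "\<delta> / C\<^sup>2", OF pos C dbl assms(4,5) index] by blast
  have R: "R > 0" using R_cases by auto
  have small_\<psi>: "\<psi> (l * t) \<le> \<delta> * l ^ d * \<psi> t" if t: "0 < t" and l: "R \<le> l" "l \<le> 2 * R" for l t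
  proof -
    have lp: "0 < l" using l R by linarith
    have "\<psi> (l * t) \<le> C * (\<delta> / C\<^sup>2 * l ^ d * \<phi> t)"
      using \<psi>_le[of "l * t"] mult_left_mono[OF small[OF t l], of C] C lp t by simp
    also have "\<dots> \<le> C * (\<delta> / C\<^sup>2 * l ^ d * (C * \<psi> t))"
      using \<phi>_le[OF t] C \<delta> lp by (intro mult_left_mono) auto
    also have "\<dots> = \<delta> * l ^ d * \<psi> t" using C by (simp add: power2_eq_square)
    finally show ?thesis .
  qed
  define v where "v = unit_ball_vol (real d) * (2 ^ d - 1) * R ^ d"
  have d1: "d \<ge> 1" by (simp add: d_def Suc_leI)
  have v: "v > 0" using d1 R one_less_power[of "2::real" d] by (simp add: v_def)
  obtain k where k: "2 * R + 2 < 2 ^ k" using real_arch_pow[of 2 "2 * R + 2"] by auto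
  define c1 where "c1 = C ^ Suc k * C * (2 * R + 1) ^ d"
  have c1: "c1 > 0" using C R by (simp add: c1_def)
  \<comment> \<open>On the annuli, \<open>norm (x - y)\<close> is comparable to \<open>norm x\<close>, because the dilations in \<open>{R..2 * R}\<close> stay away from 1.\<close>
  have kernel: "w / (\<psi> (norm x) * norm x ^ d) \<le> c1 * (w / (\<phi> (norm (x - y)) * norm (x - y) ^ d))"
    if x: "x \<noteq> 0" and y: "R * norm x \<le> norm y" "norm y \<le> 2 * (R * norm x)" and w: "w \<ge> 0"
    for x y :: "real ^ 'n" and w
  proof -
    define n m where "n = norm x" and "m = norm (x - y)"
    have n: "n > 0" using x by (simp add: n_def)
    have "m \<le> n + norm y" unfolding m_def n_def by (rule norm_triangle_ineq4)
    then have m_up: "m \<le> (2 * R + 1) * n" using y by (simp add: n_def algebra_simps)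
    have "n - norm y \<le> m" "norm y - n \<le> m"
      unfolding m_def n_def by (rule norm_triangle_ineq2, subst norm_minus_commute, rule norm_triangle_ineq2)
    then have m_low: "n \<le> 2 * m"
      using R_cases
    proof (elim disjE)
      assume "R \<ge> 2"
      then have "2 * n \<le> R * n" using n by (intro mult_right_mono) auto
      then have "2 * n \<le> norm y" using y(1) unfolding n_def by linarith
      then show ?thesis using \<open>norm y - n \<le> m\<close> n by linarith
    next
      assume "0 < R \<and> R \<le> 1/4"
      then have "R * n \<le> 1/4 * n" using n by (intro mult_right_mono) auto
      then have "norm y \<le> n / 2" using y(2) unfolding n_def by linarith
      then show ?thesis using \<open>n - norm y \<le> m\<close> by linarith
    qed
    have m: "m > 0" using m_low n by linarith
    have pw: "(2::real) ^ k \<le> 2 ^ Suc k" by simp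
    have "m \<le> 2 ^ Suc k * n"
    proof -
      have "(2 * R + 1) * n \<le> 2 ^ Suc k * n" using k pw n by (intro mult_right_mono) linarith+
      then show ?thesis using m_up by linarith
    qed
    moreover have "n \<le> 2 ^ Suc k * m"
    proof -
      have "2 * m \<le> 2 ^ Suc k * m" using k pw m R by (intro mult_right_mono) linarith+
      then show ?thesis using m_low by linarith
    qed
    ultimately have "\<phi> m \<le> C ^ Suc k * \<phi> n"
      using doubling_iterated[of C \<phi> m n k] C dbl m n by blast
    also have "\<dots> \<le> C ^ Suc k * (C * \<psi> n)" using \<phi>_le[OF n] C by (intro mult_left_mono) auto
    finally have "\<phi> m * m ^ d \<le> (C ^ Suc k * (C * \<psi> n)) * ((2 * R + 1) * n) ^ d"
      using m m_up pos[OF m] \<psi>_pos[OF n] C by (intro mult_mono power_mono) auto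
    also have "\<dots> = c1 * (\<psi> n * n ^ d)" by (simp add: c1_def power_mult_distrib mult_ac)
    finally have "\<phi> m * m ^ d \<le> c1 * (\<psi> n * n ^ d)" .
    then have "w * (\<phi> m * m ^ d) \<le> w * (c1 * (\<psi> n * n ^ d))" using w by (rule mult_left_mono)
    then show ?thesis using m n pos[OF m] \<psi>_pos[OF n]
      unfolding n_def[symmetric] m_def[symmetric] by (simp add: divide_simps mult_ac)
  qed
  define c where "c = C * (2 * 2 powr p * c1 / v)"
  have c: "c > 0" using C c1 v by (simp add: c_def)
  show ?thesis
  proof (intro exI[of _ c] conjI allI impI)
    fix u :: "real ^ 'n \<Rightarrow> real"
    assume u: "u \<in> borel_measurable lebesgue"
    define I where "I f = (\<integral>\<^sup>+x\<in>UNIV - {0}. ennreal (\<bar>u x\<bar> powr p / f (norm x)) \<partial>lebesgue)" for f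
    define Q where "Q = (\<integral>\<^sup>+x\<in>UNIV - {0}. (\<integral>\<^sup>+y\<in>UNIV - {0}.
             ennreal (\<bar>u x - u y\<bar> powr p / (\<phi> (norm (x - y)) * norm (x - y) ^ d))
             \<partial>lebesgue) \<partial>lebesgue)"
    assume "(\<integral>\<^sup>+x\<in>UNIV - {0}. ennreal (\<bar>u x\<bar> powr p / \<phi> (norm x)) \<partial>lebesgue) < \<infinity>"
    then have fin: "I \<phi> < \<infinity>" by (simp add: I_def)
    show "(\<integral>\<^sup>+x\<in>UNIV - {0}. ennreal (\<bar>u x\<bar> powr p / \<phi> (norm x)) \<partial>lebesgue)
        \<le> ennreal c *
          (\<integral>\<^sup>+x\<in>UNIV - {0}. (\<integral>\<^sup>+y\<in>UNIV - {0}.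
             ennreal (\<bar>u x - u y\<bar> powr p / (\<phi> (norm (x - y)) * norm (x - y) ^ CARD('n)))
             \<partial>lebesgue) \<partial>lebesgue)"
      unfolding I_def[of \<phi>, symmetric] d_def[symmetric] Q_def[symmetric]
    proof -
      have I\<psi>_meas: "(\<lambda>x. ennreal (\<bar>u x\<bar> powr p / \<psi> (norm x)) * indicator (UNIV - {0}) x) \<in> borel_measurable lebesgue"
      proof -
        have [measurable]: "norm \<in> borel_measurable (lebesgue :: (real ^ 'n) measure)"
          by (rule measurable_completion) simp
        have [measurable]: "UNIV - {0 :: real ^ 'n} \<in> sets lebesgue"
          by (auto simp: Compl_eq_Diff_UNIV[symmetric])
        show ?thesis using u \<psi>_meas by measurable
      qed
      have transfer: "ennreal (\<bar>u x\<bar> powr p / f (norm x)) * indicator (UNIV - {0}) x \<le>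
          ennreal C * (ennreal (\<bar>u x\<bar> powr p / g (norm x)) * indicator (UNIV - {0}) x)"
        if "\<And>t. t > 0 \<Longrightarrow> f t > 0" "\<And>t. t > 0 \<Longrightarrow> g t > 0" "\<And>t. t > 0 \<Longrightarrow> g t \<le> C * f t"
        for f g :: "real \<Rightarrow> real" and x
      proof (cases "x = 0")
        case False
        define n where "n = norm x"
        have n: "f n > 0" "g n > 0" "g n \<le> C * f n" using False that by (auto simp: n_def)
        have "\<bar>u x\<bar> powr p * g n \<le> \<bar>u x\<bar> powr p * (C * f n)" using n by (intro mult_left_mono) auto
        then have "\<bar>u x\<bar> powr p / f n \<le> C * (\<bar>u x\<bar> powr p / g n)"
          using n by (simp add: divide_simps mult_ac)
        then have "ennreal (\<bar>u x\<bar> powr p / f n) \<le> ennreal C * ennreal (\<bar>u x\<bar> powr p / g n)"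
          using C n by (simp add: ennreal_mult[symmetric] ennreal_leI)
        then show ?thesis using False by (simp add: n_def)
      qed simp
      have "I \<psi> \<le> ennreal C * I \<phi>"
        unfolding I_def using C by (intro nn_integral_le_cmult I\<psi>_meas transfer \<psi>_pos pos \<phi>_le) auto
      also have "\<dots> < \<infinity>" using fin by (simp add: ennreal_mult_less_top)
      finally have fin_\<psi>: "I \<psi> < \<infinity>" .
      have "I \<phi> \<le> (\<integral>\<^sup>+x. ennreal C * (ennreal (\<bar>u x\<bar> powr p / \<psi> (norm x)) * indicator (UNIV - {0}) x) \<partial>lebesgue)"
        unfolding I_def by (intro nn_integral_mono transfer \<psi>_pos pos \<psi>_le)
      also have "\<dots> = ennreal C * I \<psi>"
        unfolding I_def by (rule nn_integral_cmult[OF I\<psi>_meas])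
      also have "I \<psi> \<le> ennreal (2 * 2 powr p * c1 / v) * Q"
      proof -
        define T where "T x y = ennreal (\<bar>u x - u y\<bar> powr p / (\<phi> (norm (x - y)) * norm (x - y) ^ d))
            * indicator (UNIV - {0}) y * indicator (UNIV - {0}) x" for x y
        have T: "ennreal (\<bar>u x - u y\<bar> powr p / (\<psi> (norm x) * norm x ^ d)) \<le> ennreal c1 * T x y"
          if xy: "x \<noteq> 0" "R * norm x \<le> norm y" "norm y \<le> 2 * (R * norm x)" for x y
        proof -
          have "R * norm x > 0" using R xy(1) by simp
          then have "y \<noteq> 0" using xy(2) by auto
          then have "T x y = ennreal (\<bar>u x - u y\<bar> powr p / (\<phi> (norm (x - y)) * norm (x - y) ^ d))"
            using xy(1) by (simp add: T_def)
          then show ?thesis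
            using kernel[OF xy, of "\<bar>u x - u y\<bar> powr p"] c1
            by (simp add: ennreal_mult'[symmetric] ennreal_leI)
        qed
        have "(\<integral>\<^sup>+x. (\<integral>\<^sup>+y. T x y \<partial>lebesgue) \<partial>lebesgue) = Q"
          unfolding Q_def
        proof (rule nn_integral_cong)
          show "(\<integral>\<^sup>+y. T x y \<partial>lebesgue) = (\<integral>\<^sup>+y\<in>UNIV - {0}.
             ennreal (\<bar>u x - u y\<bar> powr p / (\<phi> (norm (x - y)) * norm (x - y) ^ d)) \<partial>lebesgue)
             * indicator (UNIV - {0}) x" for x
            by (cases "x = 0") (auto simp: T_def)
        qed
        then show ?thesis
          using hardy_by_averaging[where u = u and \<psi> = \<psi> and p = p and R = R and \<delta> = \<delta> and \<kappa> = c1 and T = T]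
            assms(1) R \<psi>_meas \<psi>_pos small_\<psi> \<delta> u fin_\<psi> c1 T
          by (simp add: I_def d_def v_def)
      qed
      finally have "I \<phi> \<le> ennreal C * (ennreal (2 * 2 powr p * c1 / v) * Q)"
        by (simp add: mult_left_mono)
      also have "\<dots> = ennreal c * Q"
        using C c1 v by (simp only: c_def mult.assoc[symmetric]) (subst ennreal_mult, auto)
      finally show "I \<phi> \<le> ennreal c * Q" .
    qed
  qed (rule c)
qed

end
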